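(* Given an initial diagonal of $n$ nodes, the transformation DL-Partitioning (described in the context) transforms it into a horizontal straight line of $n$ nodes in $O(n\sqrt{n})$ line moves.
   Context: Nodes occupy distinct cells of the two-dimensional square grid, cells addressed by integer coordinates $(x,y)$. A shape is a finite set of nodes. A line is a set of one or more nodes occupying consecutive cells of one row or column. A line move (one step): a line of $k\ge1$ nodes occupying $(x_1,y),\dots,(x_1+k-1,y)$ may move right by one cell if $(x_1+k,y)$ is empty, or left by one cell if $(x_1-1,y)$ is empty; vertical lines move up/down analogously; all nodes move simultaneously. Connectivity need not be preserved during the transformation. A diagonal of order $n$ is a shape with nodes at $(x+j,y+j)$, $j=0,\dots,n-1$. DL-Partitioning: divide the diagonal into $\lceil\sqrt n\rceil$ consecutive diagonal segments of length $\lfloor\sqrt n\rfloor$ (apart possibly from one shorter one). Phase 1: in each segment, move each node individually (horizontally) to the leftmost column of that segment, forming a vertical line segment. Phase 2: push each vertical line segment down to the bottommost row $y$ of the diagonal. Phase 3: turn each segment into row $y$, so that all nodes form a horizontal line in row $y$.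
   Formalization: The number of segments is taken as ⌈n/⌊√n⌋⌉ instead of ⌈√n⌉, because ⌈√n⌉ segments of length at most ⌊√n⌋ do not cover the diagonal for some n (e.g. n = 3, 7, 8); the two numbers agree whenever ⌈√n⌉ segments suffice. *)

theory Defs
  imports Complex_Main "HOL-Library.Landau_Symbols"
begin

type_synonym cell = "int \<times> int"

type_synonym shape = "cell set"

definition horizontal_line :: "int \<Rightarrow> int \<Rightarrow> nat \<Rightarrow> shape" where
  "horizontal_line x y k = (\<lambda>j. (x + int j, y)) ` {..<k}"

definition vertical_line :: "int \<Rightarrow> int \<Rightarrow> nat \<Rightarrow> shape" where
  "vertical_line x y k = (\<lambda>j. (x, y + int j)) ` {..<k}"

definition diagonal :: "int \<Rightarrow> int \<Rightarrow> nat \<Rightarrow> shape" where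
  "diagonal x y n = (\<lambda>j. (x + int j, y + int j)) ` {..<n}"

datatype direction = Right | Left | Up | Down

text \<open>
  In \<open>Move d x y k\<close>, the cell \<open>(x, y)\<close> is the leftmost (horizontal moves) or bottommost
  (vertical moves) cell of the moving line, whatever the direction \<open>d\<close>, and \<open>k\<close> is the number of
  its nodes. The line need not be maximal in the shape; a single node counts as a line of both
  orientations.
\<close>

datatype move = Move direction int int nat

fun moving_line :: "move \<Rightarrow> shape" where
  "moving_line (Move Right x y k) = horizontal_line x y k"
| "moving_line (Move Left x y k) = horizontal_line x y k"
| "moving_line (Move Up x y k) = vertical_line x y k"
| "moving_line (Move Down x y k) = vertical_line x y k"

fun moved_line :: "move \<Rightarrow> shape" where
  "moved_line (Move Right x y k) = horizontal_line (x + 1) y k"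
| "moved_line (Move Left x y k) = horizontal_line (x - 1) y k"
| "moved_line (Move Up x y k) = vertical_line x (y + 1) k"
| "moved_line (Move Down x y k) = vertical_line x (y - 1) k"

fun front_cell :: "move \<Rightarrow> cell" where
  "front_cell (Move Right x y k) = (x + int k, y)"
| "front_cell (Move Left x y k) = (x - 1, y)"
| "front_cell (Move Up x y k) = (x, y + int k)"
| "front_cell (Move Down x y k) = (x, y - 1)"

definition legal :: "shape \<Rightarrow> move \<Rightarrow> bool" where
  "legal S m \<longleftrightarrow> moving_line m \<noteq> {} \<and> moving_line m \<subseteq> S \<and> front_cell m \<notin> S"

definition apply_move :: "move \<Rightarrow> shape \<Rightarrow> shape" where
  "apply_move m S = (S - moving_line m) \<union> moved_line m"

text \<open>The result is \<^const>\<open>None\<close> as soon as some move of the sequence is not legal.\<close>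

fun run :: "move list \<Rightarrow> shape \<Rightarrow> shape option" where
  "run [] S = Some S"
| "run (m # ms) S = (if legal S m then run ms (apply_move m S) else None)"

text \<open>
  The nodes of the diagonal are cut, from bottom left to top right, into segments of length
  \<open>\<lfloor>sqrt n\<rfloor>\<close>, the last one possibly shorter. \<open>\<lceil>sqrt n\<rceil>\<close> such segments do not always contain all
  \<open>n\<close> nodes (for instance, \<open>n = 7\<close> would need \<open>3 * 2 \<ge> 7\<close>), so the number of segments is
  the number needed to cover the diagonal. It is \<open>\<lceil>sqrt n\<rceil>\<close> whenever that suffices, and one more
  otherwise.
\<close>

definition seg_length :: "nat \<Rightarrow> nat" where
  "seg_length n = nat \<lfloor>sqrt (real n)\<rfloor>"

definition num_segs :: "nat \<Rightarrow> nat" where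
  "num_segs n = nat \<lceil>real n / real (seg_length n)\<rceil>"

definition seg_start :: "nat \<Rightarrow> nat \<Rightarrow> nat" where
  "seg_start n i = i * seg_length n"

definition seg_size :: "nat \<Rightarrow> nat \<Rightarrow> nat" where
  "seg_size n i = min (seg_length n) (n - seg_start n i)"

text \<open>
  The \<open>j\<close>-th node of segment \<open>i\<close> starts at offset \<open>s + j\<close> on the diagonal, where
  \<open>s = seg_start n i\<close>, and has to travel \<open>j\<close> cells to column \<open>x + s\<close>.
\<close>

definition gather_phase :: "int \<Rightarrow> int \<Rightarrow> nat \<Rightarrow> move list" where
  "gather_phase x y n =
     [Move Left (x + int (seg_start n i) + int j - int t) (y + int (seg_start n i) + int j) 1.
        i \<leftarrow> [0..<num_segs n], j \<leftarrow> [0..<seg_size n i], t \<leftarrow> [0..<j]]"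

definition push_down_phase :: "int \<Rightarrow> int \<Rightarrow> nat \<Rightarrow> move list" where
  "push_down_phase x y n =
     [Move Down (x + int (seg_start n i)) (y + int (seg_start n i) - int t) (seg_size n i).
        i \<leftarrow> [0..<num_segs n], t \<leftarrow> [0..<seg_start n i]]"

text \<open>
  Turns the vertical line of length \<open>l\<close> with bottom cell \<open>(a, b)\<close> into row \<open>b\<close>: push the \<open>t\<close>
  nodes that are already in row \<open>b\<close> one cell to the right, then push the remaining \<open>l - t\<close> nodes
  of column \<open>a\<close> one cell down.
\<close>

definition turn :: "int \<Rightarrow> int \<Rightarrow> nat \<Rightarrow> move list" where
  "turn a b l = concat (map (\<lambda>t. [Move Right a b t, Move Down a (b + 1) (l - t)]) [1..<l])"

definition turn_phase :: "int \<Rightarrow> int \<Rightarrow> nat \<Rightarrow> move list" where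
  "turn_phase x y n =
     concat (map (\<lambda>i. turn (x + int (seg_start n i)) y (seg_size n i)) [0..<num_segs n])"

definition dl_partitioning :: "int \<Rightarrow> int \<Rightarrow> nat \<Rightarrow> move list" where
  "dl_partitioning x y n = gather_phase x y n @ push_down_phase x y n @ turn_phase x y n"

end

theory Submission
  imports Defs "HOL-Library.Disjoint_Sets"
begin

text \<open>
  Moves confined to pairwise disjoint regions do not interfere, so each phase can be analysed
  segment by segment: in the first phase a segment owns its rows (and each node its row), in the
  other two its columns. With \<open>L = \<lfloor>sqrt n\<rfloor>\<close> there are at most \<open>3 sqrt n\<close> segments, each of which
  needs at most \<open>L\<^sup>2 \<le> n\<close> moves for gathering, \<open>n\<close> for pushing down and \<open>2 L\<close> for turning.
\<close>

section \<open>Coordinate descriptions of lines and diagonals\<close>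

lemma mem_horizontal_line_iff:
  "(p, q) \<in> horizontal_line x y k \<longleftrightarrow> q = y \<and> x \<le> p \<and> p < x + int k"
proof
  assume "q = y \<and> x \<le> p \<and> p < x + int k"
  then show "(p, q) \<in> horizontal_line x y k"
    by (auto simp: horizontal_line_def intro!: image_eqI[where x = "nat (p - x)"])
qed (auto simp: horizontal_line_def)

lemma mem_vertical_line_iff:
  "(p, q) \<in> vertical_line x y k \<longleftrightarrow> p = x \<and> y \<le> q \<and> q < y + int k"
proof
  assume "p = x \<and> y \<le> q \<and> q < y + int k"
  then show "(p, q) \<in> vertical_line x y k"
    by (auto simp: vertical_line_def intro!: image_eqI[where x = "nat (q - y)"])
qed (auto simp: vertical_line_def)

lemma mem_diagonal_iff:
  "(p, q) \<in> diagonal x y n \<longleftrightarrow> p - x = q - y \<and> x \<le> p \<and> p < x + int n"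
proof
  assume "p - x = q - y \<and> x \<le> p \<and> p < x + int n"
  then show "(p, q) \<in> diagonal x y n"
    by (auto simp: diagonal_def intro!: image_eqI[where x = "nat (p - x)"])
qed (auto simp: diagonal_def)

lemma horizontal_line_eq_empty_iff [simp]: "horizontal_line x y k = {} \<longleftrightarrow> k = 0"
  by (auto simp: horizontal_line_def)

lemma vertical_line_eq_empty_iff [simp]: "vertical_line x y k = {} \<longleftrightarrow> k = 0"
  by (auto simp: vertical_line_def)

section \<open>Locality of moves and runs in disjoint regions\<close>

lemma moved_line_subset: "moved_line m \<subseteq> insert (front_cell m) (moving_line m)"
  by (cases m rule: moved_line.cases)
     (auto simp: mem_horizontal_line_iff mem_vertical_line_iff)

text \<open>The front cell is the only cell that a legal move can newly occupy, so conditions on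
  front cells alone control the region that a run reaches.\<close>

lemma apply_move_subset: "legal S m \<Longrightarrow> apply_move m S \<subseteq> insert (front_cell m) S"
  using moved_line_subset[of m] unfolding apply_move_def legal_def by blast

lemma run_append:
  "run (ms @ ms') S = (case run ms S of None \<Rightarrow> None | Some S' \<Rightarrow> run ms' S')"
  by (induction ms arbitrary: S) auto

lemma run_subset:
  assumes "run ms A = Some B" "A \<subseteq> R" "\<And>m. m \<in> set ms \<Longrightarrow> front_cell m \<in> R"
  shows "B \<subseteq> R"
  using assms
proof (induction ms arbitrary: A)
  case (Cons m ms)
  have legal: "legal A m" and run: "run ms (apply_move m A) = Some B"
    using Cons.prems(1) by (auto split: if_splits)
  have "apply_move m A \<subseteq> R"
    using apply_move_subset[OF legal] Cons.prems(2) Cons.prems(3)[of m] by auto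
  with Cons.IH[OF run] Cons.prems(3) show ?case by simp
qed simp

text \<open>Frame rule: \<open>C\<close> is a passive part of the shape. Moving lines lie in the
  active part, so they never pick up cells of \<open>C\<close>, and front cells outside
  \<open>C\<close> stay as free as they were without \<open>C\<close>.\<close>

lemma run_frame:
  assumes "run ms A = Some B" "A \<inter> C = {}" "\<And>m. m \<in> set ms \<Longrightarrow> front_cell m \<notin> C"
  shows "run ms (A \<union> C) = Some (B \<union> C)"
  using assms
proof (induction ms arbitrary: A)
  case (Cons m ms)
  have legal: "legal A m" and run: "run ms (apply_move m A) = Some B"
    using Cons.prems(1) by (auto split: if_splits)
  have "apply_move m A \<inter> C = {}"
    using apply_move_subset[OF legal] Cons.prems(2) Cons.prems(3)[of m] by auto
  with Cons.IH[OF run] Cons.prems(3)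
  have "run ms (apply_move m A \<union> C) = Some (B \<union> C)" by simp
  moreover have "apply_move m (A \<union> C) = apply_move m A \<union> C"
    using legal Cons.prems(2) unfolding apply_move_def legal_def by blast
  moreover have "legal (A \<union> C) m"
    using legal Cons.prems(3)[of m] by (auto simp: legal_def)
  ultimately show ?case by simp
qed simp

text \<open>Induction on \<open>N\<close> with two uses of the frame rule: the first
  \<open>N\<close> lists run while \<open>A N\<close> is passive, then the last list runs while the
  results of the others are passive.\<close>

lemma run_concat_disjoint:
  assumes "\<And>i. i < N \<Longrightarrow> run (ms i) (A i) = Some (B i)"
    and "\<And>i. i < N \<Longrightarrow> A i \<subseteq> R i"
    and "\<And>i m. i < N \<Longrightarrow> m \<in> set (ms i) \<Longrightarrow> front_cell m \<in> R i"
    and "disjoint_family_on R {..<N}"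
  shows "run (concat (map ms [0..<N])) (\<Union>i<N. A i) = Some (\<Union>i<N. B i)"
  using assms
proof (induction N)
  case (Suc N)
  have "R i \<inter> R N = {}" if "i < N" for i
    using Suc.prems(4) that by (simp add: disjoint_family_on_def)
  then have disj: "(\<Union>i<N. R i) \<inter> R N = {}"
    by blast
  have IH: "run (concat (map ms [0..<N])) (\<Union>i<N. A i) = Some (\<Union>i<N. B i)"
  proof (rule Suc.IH)
    show "disjoint_family_on R {..<N}"
      by (rule disjoint_family_on_mono[OF _ Suc.prems(4)]) auto
  qed (use Suc.prems(1-3) less_SucI in blast)+
  have sub: "(\<Union>i<N. A i) \<subseteq> (\<Union>i<N. R i)" "A N \<subseteq> R N"
    by (rule UN_mono) (simp_all add: Suc.prems(2))
  have front: "front_cell m \<in> (\<Union>i<N. R i)" if "m \<in> set (concat (map ms [0..<N]))" for m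
  proof -
    obtain i where "i < N" "m \<in> set (ms i)"
      using \<open>m \<in> set (concat (map ms [0..<N]))\<close> by auto
    with Suc.prems(3)[of i m] show ?thesis by auto
  qed
  \<comment> \<open>The earlier lists never leave their own regions, so their results cannot
    obstruct list \<open>N\<close>.\<close>
  have B: "(\<Union>i<N. B i) \<subseteq> (\<Union>i<N. R i)"
    using run_subset[OF IH sub(1) front] .
  have "run (concat (map ms [0..<N])) ((\<Union>i<N. A i) \<union> A N) = Some ((\<Union>i<N. B i) \<union> A N)"
  proof (rule run_frame[OF IH])
    show "(\<Union>i<N. A i) \<inter> A N = {}"
      using disj sub by blast
    show "front_cell m \<notin> A N" if "m \<in> set (concat (map ms [0..<N]))" for m
      using front[OF that] disj sub(2) by blast
  qed
  moreover have "run (ms N) (A N \<union> (\<Union>i<N. B i)) = Some (B N \<union> (\<Union>i<N. B i))"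
  proof (rule run_frame)
    show "run (ms N) (A N) = Some (B N)"
      using Suc.prems(1) by simp
    show "A N \<inter> (\<Union>i<N. B i) = {}"
      using disj B sub(2) by blast
    show "front_cell m \<notin> (\<Union>i<N. B i)" if "m \<in> set (ms N)" for m
      using disj B Suc.prems(3)[OF lessI that] by blast
  qed
  ultimately show ?case
    by (simp add: run_append lessThan_Suc Un_commute)
qed simp

section \<open>Translating and turning a single line\<close>

lemma run_left:
  "k > 0 \<Longrightarrow> run (map (\<lambda>t. Move Left (a - int t) b k) [0..<j]) (horizontal_line a b k)
     = Some (horizontal_line (a - int j) b k)"
  by (induction j)
     (auto simp: run_append legal_def apply_move_def mem_horizontal_line_iff algebra_simps)

lemma run_down:
  "k > 0 \<Longrightarrow> run (map (\<lambda>t. Move Down a (b - int t) k) [0..<j]) (vertical_line a b k)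
     = Some (vertical_line a (b - int j) k)"
  by (induction j)
     (auto simp: run_append legal_def apply_move_def mem_vertical_line_iff algebra_simps)

text \<open>Row and column share the corner \<open>(a, b)\<close>. Pushing the row right vacates the
  corner, and the column above it then descends into it; the corner is counted in both lengths,
  whence the \<open>+ 1\<close> and the \<open>Suc\<close>.\<close>

lemma run_turn_step:
  assumes "0 < t" "t < l"
  shows "run [Move Right a b t, Move Down a (b + 1) (l - t)]
           (horizontal_line a b t \<union> vertical_line a b (l - t + 1))
         = Some (horizontal_line a b (Suc t) \<union> vertical_line a b (l - t))"
proof -
  let ?S = "horizontal_line a b t \<union> vertical_line a b (l - t + 1)"
  let ?S' = "horizontal_line (a + 1) b t \<union> vertical_line a (b + 1) (l - t)"
  have "legal ?S (Move Right a b t)"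
    using assms by (auto simp: legal_def mem_horizontal_line_iff mem_vertical_line_iff)
  moreover have "apply_move (Move Right a b t) ?S = ?S'"
    using assms by (auto simp: apply_move_def mem_horizontal_line_iff mem_vertical_line_iff)
  moreover have "legal ?S' (Move Down a (b + 1) (l - t))"
    using assms by (auto simp: legal_def mem_horizontal_line_iff mem_vertical_line_iff)
  moreover have "apply_move (Move Down a (b + 1) (l - t)) ?S'
      = horizontal_line a b (Suc t) \<union> vertical_line a b (l - t)"
    using assms by (auto simp: apply_move_def mem_horizontal_line_iff mem_vertical_line_iff)
  ultimately show ?thesis by simp
qed

lemma run_turn: "run (turn a b l) (vertical_line a b l) = Some (horizontal_line a b l)"
proof (cases l)
  case 0
  then show ?thesis by (simp add: turn_def vertical_line_def horizontal_line_def)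
next
  case (Suc k)
  let ?ms = "\<lambda>t. [Move Right a b t, Move Down a (b + 1) (l - t)]"
  \<comment> \<open>Invariant after \<open>u\<close> rounds: the row has \<open>u + 1\<close> nodes
    and the column \<open>l - u\<close>, with the corner in common.\<close>
  have "run (concat (map ?ms [1..<Suc u])) (vertical_line a b l)
      = Some (horizontal_line a b (Suc u) \<union> vertical_line a b (l - u))" if "u < l" for u
    using that
  proof (induction u)
    case 0
    then show ?case by (auto simp: mem_horizontal_line_iff mem_vertical_line_iff)
  next
    case (Suc u)
    have "concat (map ?ms [1..<Suc (Suc u)]) = concat (map ?ms [1..<Suc u]) @ ?ms (Suc u)"
      by simp
    moreover have "l - Suc u + 1 = l - u"
      using Suc.prems by simp
    ultimately show ?case
      using Suc run_turn_step[of "Suc u" l a b] by (simp only: run_append) simp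
  qed
  \<comment> \<open>After \<open>k = l - 1\<close> rounds the column has shrunk to the corner, which
    belongs to the row.\<close>
  from this[of k] show ?thesis
    using Suc by (auto simp: turn_def mem_horizontal_line_iff mem_vertical_line_iff)
qed

section \<open>Length, number and position of the segments\<close>

lemma seg_length_le: "real (seg_length n) \<le> sqrt (real n)"
  unfolding seg_length_def by simp

text \<open>With \<open>L\<close> the segment length, rounding down loses less than 1, so sqrt n < L
  + 1, and L + 1 \<le> 2 L because L \<ge> 1.\<close>

lemma seg_length_ge:
  assumes "n \<ge> 1"
  shows "seg_length n \<ge> 1" and "sqrt (real n) \<le> 2 * real (seg_length n)"
proof -
  show ge1: "seg_length n \<ge> 1"
    using assms by (simp add: seg_length_def le_nat_iff le_floor_iff)
  have "sqrt (real n) < real (seg_length n) + 1"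
    unfolding seg_length_def by simp
  with ge1 show "sqrt (real n) \<le> 2 * real (seg_length n)" by linarith
qed

text \<open>An integer is below a ceiling iff it is below the number itself. This replaces the
  ceiling by the condition that the segment starts on the diagonal.\<close>

lemma less_num_segs_iff:
  assumes "n \<ge> 1"
  shows "i < num_segs n \<longleftrightarrow> seg_start n i < n"
proof -
  have "i < num_segs n \<longleftrightarrow> real i < real n / real (seg_length n)"
    by (simp add: num_segs_def zless_nat_eq_int_zless less_ceiling_iff)
  also have "\<dots> \<longleftrightarrow> real (i * seg_length n) < real n"
    using seg_length_ge(1)[OF assms] by (simp add: pos_less_divide_eq)
  finally show ?thesis by (simp only: seg_start_def of_nat_less_iff)
qed

text \<open>The quotient is at most 2 sqrt n because the segment length is at least half of sqrt n;
  rounding up costs at most 1 \<le> sqrt n.\<close>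

lemma num_segs_le:
  assumes "n \<ge> 1"
  shows "real (num_segs n) \<le> 3 * sqrt (real n)"
proof -
  have "real (num_segs n) \<le> real n / real (seg_length n) + 1"
    unfolding num_segs_def by simp
  also have "real n / real (seg_length n) \<le> 2 * sqrt (real n)"
  proof -
    have "real n = sqrt (real n) * sqrt (real n)" by simp
    also have "\<dots> \<le> sqrt (real n) * (2 * real (seg_length n))"
      by (intro mult_left_mono seg_length_ge assms) simp
    finally show ?thesis
      using seg_length_ge(1)[OF assms] by (simp add: pos_divide_le_eq mult_ac)
  qed
  also have "1 \<le> sqrt (real n)" using assms by simp
  finally show ?thesis by simp
qed

lemma seg_size_pos:
  assumes "n \<ge> 1" "i < num_segs n"
  shows "seg_size n i > 0"
  using assms less_num_segs_iff[of n i] seg_length_ge(1)[of n] by (simp add: seg_size_def)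

lemma seg_end_le_seg_start: "i < j \<Longrightarrow> seg_start n i + seg_size n i \<le> seg_start n j"
proof -
  assume "i < j"
  then have "Suc i * seg_length n \<le> j * seg_length n"
    by (intro mult_le_mono1) simp
  then show ?thesis by (simp add: seg_start_def seg_size_def)
qed

text \<open>Offsets are integers relative to the corner of the diagonal, so the same set describes a
  band of columns (via \<open>fst c - x\<close>) and a band of rows (via
  \<open>snd c - y\<close>).\<close>

definition segment :: "nat \<Rightarrow> nat \<Rightarrow> int set" where
  "segment n i = {int (seg_start n i)..<int (seg_start n i + seg_size n i)}"

lemma disjoint_family_segment: "disjoint_family (segment n)"
  unfolding disjoint_family_on_def
proof (intro ballI impI)
  fix i j :: nat assume "i \<noteq> j"
  then consider "i < j" | "j < i" by linarith
  then show "segment n i \<inter> segment n j = {}"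
    by cases (auto simp: segment_def dest!: seg_end_le_seg_start[where n = n])
qed

lemma Union_segment:
  assumes "n \<ge> 1"
  shows "(\<Union>i<num_segs n. segment n i) = {0..<int n}"
proof (intro equalityI subsetI)
  fix z assume z: "z \<in> {0..<int n}"
  \<comment> \<open>Division by the segment length finds the segment of an offset; its index is
    valid because its start is at most \<open>z\<close>, hence below \<open>n\<close>.\<close>
  let ?i = "nat z div seg_length n"
  have start: "seg_start n ?i \<le> nat z"
    by (simp add: seg_start_def)
  have "nat z < seg_start n ?i + seg_length n"
    using seg_length_ge(1)[OF assms] dividend_less_div_times[of "seg_length n" "nat z"]
    by (simp add: seg_start_def)
  with z start have "z \<in> segment n ?i"
    by (auto simp: segment_def seg_size_def)
  moreover have "?i < num_segs n"
    using z le_less_trans[OF start, of n] by (auto simp: less_num_segs_iff[OF assms])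
  ultimately show "z \<in> (\<Union>i<num_segs n. segment n i)" by blast
qed (auto simp: segment_def seg_size_def)

lemma Union_segment_iff:
  assumes "n \<ge> 1"
  shows "(\<exists>i<num_segs n. z \<in> segment n i) \<longleftrightarrow> 0 \<le> z \<and> z < int n"
  using Union_segment[OF assms] by (auto simp: set_eq_iff)

text \<open>A cell of the diagonal is determined by its column, so cutting the column offsets into
  segments cuts the diagonal.\<close>

lemma diagonal_eq_Union:
  assumes "n \<ge> 1"
  shows "diagonal x y n = (\<Union>i<num_segs n.
    diagonal (x + int (seg_start n i)) (y + int (seg_start n i)) (seg_size n i))"
proof -
  have "c \<in> diagonal x y n \<longleftrightarrow> c \<in> (\<Union>i<num_segs n.
    diagonal (x + int (seg_start n i)) (y + int (seg_start n i)) (seg_size n i))" for c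
    using Union_segment_iff[OF assms, of "fst c - x"]
    by (cases c) (auto simp: mem_diagonal_iff segment_def algebra_simps)
  then show ?thesis by blast
qed

lemma horizontal_line_eq_Union:
  assumes "n \<ge> 1"
  shows "horizontal_line x y n = (\<Union>i<num_segs n.
    horizontal_line (x + int (seg_start n i)) y (seg_size n i))"
proof -
  have "c \<in> horizontal_line x y n \<longleftrightarrow> c \<in> (\<Union>i<num_segs n.
    horizontal_line (x + int (seg_start n i)) y (seg_size n i))" for c
    using Union_segment_iff[OF assms, of "fst c - x"]
    by (cases c) (auto simp: mem_horizontal_line_iff segment_def algebra_simps)
  then show ?thesis by blast
qed

section \<open>Correctness of the three phases\<close>

lemma run_gather_segment:
  "run (concat (map (\<lambda>j. map (\<lambda>t. Move Left (a + int j - int t) (b + int j) 1) [0..<j]) [0..<l]))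
     (diagonal a b l) = Some (vertical_line a b l)"
proof -
  let ?ms = "\<lambda>j. map (\<lambda>t. Move Left (a + int j - int t) (b + int j) 1) [0..<j]"
  have "run (concat (map ?ms [0..<l])) (\<Union>j<l. horizontal_line (a + int j) (b + int j) 1)
      = Some (\<Union>j<l. horizontal_line a (b + int j) 1)"
  \<comment> \<open>Each node is a line of length 1 that stays in its own row.\<close>
  proof (rule run_concat_disjoint[where R = "\<lambda>j. UNIV \<times> {b + int j}"])
    show "run (?ms j) (horizontal_line (a + int j) (b + int j) 1)
        = Some (horizontal_line a (b + int j) 1)" for j
      using run_left[of 1 "a + int j" "b + int j" j] by simp
  qed (auto simp: horizontal_line_def disjoint_family_on_def)
  moreover have "(\<Union>j<l. horizontal_line (a + int j) (b + int j) 1) = diagonal a b l"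
    by (auto simp: horizontal_line_def diagonal_def)
  moreover have "(\<Union>j<l. horizontal_line a (b + int j) 1) = vertical_line a b l"
    by (auto simp: horizontal_line_def vertical_line_def)
  ultimately show ?thesis by simp
qed

lemma run_gather_phase:
  assumes "n \<ge> 1"
  shows "run (gather_phase x y n) (diagonal x y n) = Some (\<Union>i<num_segs n.
    vertical_line (x + int (seg_start n i)) (y + int (seg_start n i)) (seg_size n i))"
  unfolding gather_phase_def diagonal_eq_Union[OF assms]
proof (rule run_concat_disjoint[where R = "\<lambda>i. {c. snd c - y \<in> segment n i}"])
  show "disjoint_family_on (\<lambda>i. {c. snd c - y \<in> segment n i}) {..<num_segs n}"
    using disjoint_family_segment[of n] by (auto simp: disjoint_family_on_def)
qed (auto simp: run_gather_segment[simplified] mem_diagonal_iff segment_def)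

lemma run_push_down_phase:
  assumes "n \<ge> 1"
  shows "run (push_down_phase x y n) (\<Union>i<num_segs n.
      vertical_line (x + int (seg_start n i)) (y + int (seg_start n i)) (seg_size n i))
    = Some (\<Union>i<num_segs n. vertical_line (x + int (seg_start n i)) y (seg_size n i))"
  unfolding push_down_phase_def
proof (rule run_concat_disjoint[where R = "\<lambda>i. {c. fst c - x \<in> segment n i}"])
  fix i assume "i < num_segs n"
  \<comment> \<open>An empty line may not move, so legality requires a nonempty segment.\<close>
  note pos = seg_size_pos[OF assms this]
  show "run (map (\<lambda>t. Move Down (x + int (seg_start n i)) (y + int (seg_start n i) - int t)
        (seg_size n i)) [0..<seg_start n i])
      (vertical_line (x + int (seg_start n i)) (y + int (seg_start n i)) (seg_size n i))
    = Some (vertical_line (x + int (seg_start n i)) y (seg_size n i))"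
    using run_down[OF pos, of _ "y + int (seg_start n i)"] by simp
next
  show "disjoint_family_on (\<lambda>i. {c. fst c - x \<in> segment n i}) {..<num_segs n}"
    using disjoint_family_segment[of n] by (auto simp: disjoint_family_on_def)
qed (auto simp: mem_vertical_line_iff segment_def seg_size_pos[OF assms])

text \<open>A turned segment fills exactly the columns that its nodes occupied on the original
  diagonal, so the resulting rows abut without gap or overlap.\<close>

lemma run_turn_phase:
  assumes "n \<ge> 1"
  shows "run (turn_phase x y n)
      (\<Union>i<num_segs n. vertical_line (x + int (seg_start n i)) y (seg_size n i))
    = Some (horizontal_line x y n)"
  unfolding turn_phase_def horizontal_line_eq_Union[OF assms]
proof (rule run_concat_disjoint[where R = "\<lambda>i. {c. fst c - x \<in> segment n i}"])
  show "disjoint_family_on (\<lambda>i. {c. fst c - x \<in> segment n i}) {..<num_segs n}"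
    using disjoint_family_segment[of n] by (auto simp: disjoint_family_on_def)
  \<comment> \<open>A right push of \<open>t\<close> nodes ends \<open>t\<close> columns to the
    right of the segment start, and \<open>t\<close> is less than the segment size; down pushes stay
    in the first column.\<close>
  show "front_cell m \<in> {c. fst c - x \<in> segment n i}"
    if "m \<in> set (turn (x + int (seg_start n i)) y (seg_size n i))" for i m
    using that by (auto simp: turn_def segment_def)
qed (auto simp: run_turn mem_vertical_line_iff segment_def)

lemma run_dl_partitioning:
  assumes "n \<ge> 1"
  shows "run (dl_partitioning x y n) (diagonal x y n) = Some (horizontal_line x y n)"
  using assms by (simp add: dl_partitioning_def run_append run_gather_phase
    run_push_down_phase run_turn_phase)

section \<open>Counting the moves\<close>

lemma length_concat_map_le:
  assumes "\<And>x. x \<in> set xs \<Longrightarrow> length (f x) \<le> b"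
  shows "length (concat (map f xs)) \<le> length xs * b"
  using assms by (induction xs) (auto intro: add_mono)

lemma seg_size_le: "seg_size n i \<le> seg_length n"
  by (simp add: seg_size_def)

text \<open>Each of the \<open>l\<close> nodes makes fewer than \<open>l\<close> moves.\<close>

lemma length_gather_segment_le:
  "length (concat (map (\<lambda>j. map (f j) [0..<j]) [0..<l])) \<le> l\<^sup>2"
  by (rule order_trans[OF length_concat_map_le[where b = l]]) (auto simp: power2_eq_square)

lemma length_gather_phase: "length (gather_phase x y n) \<le> num_segs n * (seg_length n)\<^sup>2"
  unfolding gather_phase_def
  by (rule order_trans[OF length_concat_map_le[where b = "(seg_length n)\<^sup>2"]],
      rule order_trans[OF length_gather_segment_le])
     (simp_all add: power_mono seg_size_le)

text \<open>A segment descends by its start offset, which is below \<open>n\<close> for every valid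
  index.\<close>

lemma length_push_down_phase:
  assumes "n \<ge> 1"
  shows "length (push_down_phase x y n) \<le> num_segs n * n"
  unfolding push_down_phase_def
  by (intro order_trans[OF length_concat_map_le[where b = n]])
     (auto simp: less_num_segs_iff[OF assms])

lemma length_turn_le: "length (turn a b l) \<le> 2 * l"
  unfolding turn_def by (intro order_trans[OF length_concat_map_le[where b = 2]]) auto

lemma length_turn_phase: "length (turn_phase x y n) \<le> num_segs n * (2 * seg_length n)"
  unfolding turn_phase_def
  by (intro order_trans[OF length_concat_map_le[where b = "2 * seg_length n"]])
     (auto intro!: order_trans[OF length_turn_le] seg_size_le)

lemma length_dl_partitioning:
  assumes "n \<ge> 1"
  shows "real (length (dl_partitioning x y n)) \<le> 12 * (real n * sqrt (real n))"
proof -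
  let ?L = "seg_length n"
  have sq: "(real ?L)\<^sup>2 \<le> real n"
    using power_mono[OF seg_length_le, of n 2] by simp
  have "?L \<le> ?L\<^sup>2"
    by (simp add: power2_eq_square)
  then have L: "real ?L \<le> real n"
    using sq by (smt (verit) of_nat_le_iff of_nat_power)
  have "length (dl_partitioning x y n) \<le> num_segs n * (?L\<^sup>2 + n + 2 * ?L)"
    using length_gather_phase[of x y n] length_push_down_phase[OF assms, of x y]
      length_turn_phase[of x y n]
    by (simp add: dl_partitioning_def distrib_left)
  then have "real (length (dl_partitioning x y n))
      \<le> real (num_segs n * (?L\<^sup>2 + n + 2 * ?L))"
    by (simp only: of_nat_le_iff)
  also have "\<dots> = real (num_segs n) * ((real ?L)\<^sup>2 + real n + 2 * real ?L)"
    by simp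
  \<comment> \<open>The constant 12 is 3 * 4: at most 3 sqrt n segments, each costing at most n to
    gather, n to push down and 2 n to turn.\<close>
  also have "\<dots> \<le> (3 * sqrt (real n)) * (4 * real n)"
  proof (intro mult_mono num_segs_le assms)
    show "(real ?L)\<^sup>2 + real n + 2 * real ?L \<le> 4 * real n"
      using sq L by linarith
  qed simp_all
  finally show ?thesis by (simp add: mult_ac)
qed

theorem theorem3p1:
  "\<exists>T :: nat \<Rightarrow> real.
     T \<in> O(\<lambda>n. real n * sqrt (real n)) \<and>
     (\<forall>(n::nat) (x::int) (y::int). n \<ge> 1 \<longrightarrow>
        (\<exists>x'. run (dl_partitioning x y n) (diagonal x y n) = Some (horizontal_line x' y n)) \<and>
        real (length (dl_partitioning x y n)) \<le> T n)"
\<comment> \<open>The bound on the length serves as \<open>T\<close>; the final line starts in the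
  column \<open>x\<close> of the lowest node, so \<open>x' = x\<close>.\<close>
proof (intro exI[of _ "\<lambda>n. 12 * (real n * sqrt (real n))"] conjI allI impI)
  show "(\<lambda>n. 12 * (real n * sqrt (real n))) \<in> O(\<lambda>n. real n * sqrt (real n))"
    by simp
qed (use run_dl_partitioning length_dl_partitioning in auto)

end
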